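(* Let $m,n\in\{0,1,2,\ldots\}$. Then, as an identity of polynomials in $x,y,z$, $$(-1)^{m+n}\sum_{k=0}^n(-1)^{k}\binom xk\binom y{k+m}\binom z{n-k}=\sum_{k=0}^n(-1)^k\binom xk\binom{m-1-y}{k+m}\binom{n-x-z-1}{n-k}.$$ Consequently, if $x+y=-1$, then for any $d\in\{0,1,2,\ldots\}$ $$\sum_{k=0}^n(-1)^{k}\binom{n+d}{k+d}\binom xk\binom yk=(-1)^{n}\sum_{k=0}^n(-1)^k\binom xk^2\binom {y-d}{n-k},$$ and (still assuming $x+y=-1$) we have the symmetric identity, for all $z$, $$\sum_{k=0}^n(-1)^k\binom xk^2\binom{y+z}{n-k}=\sum_{k=0}^n(-1)^k\binom yk^2\binom{x+z}{n-k}.$$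
   Context: For $k\in\{0,1,2,\ldots\}$ and any $x$, $\binom xk=x(x-1)\cdots(x-k+1)/k!$ (and $\binom x0=1$). *)

theory Defs
  imports Complex_Main "HOL-Computational_Algebra.Polynomial"
begin

text \<open>
  The polynomial ring \<open>K[x,y,z]\<close> is taken as the iterated polynomial ring \<open>K[x][y][z]\<close>,
  with \<open>z\<close> the outermost indeterminate.
\<close>

type_synonym 'a poly3 = "'a poly poly poly"

definition var_x :: "'a::field_char_0 poly3" where
  "var_x = [:[:[:0, 1:]:]:]"

definition var_y :: "'a::field_char_0 poly3" where
  "var_y = [:[:0, 1:]:]"

definition var_z :: "'a::field_char_0 poly3" where
  "var_z = [:0, 1:]"

text \<open>
  The constant \<open>gchoose\<close> is constrained to fields of characteristic 0, so binomial coefficients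
  with a polynomial upper entry are defined separately; division by \<open>fact k\<close> is multiplication
  by the constant polynomial \<open>1 / fact k\<close>.
\<close>

definition poly3_binom :: "'a::field_char_0 poly3 \<Rightarrow> nat \<Rightarrow> 'a poly3" (infix \<open>pchoose\<close> 64) where
  "p pchoose k = [:[:[:1 / fact k:]:]:] * (\<Prod>i = 0..<k. p - of_nat i)"

lemma fact_mult_poly3_binom: "fact k * (p pchoose k) = (\<Prod>i = 0..<k. p - of_nat i)"
proof -
  have "(fact k :: 'a poly3) = [:[:[:fact k:]:]:]"
    by (metis of_nat_fact of_nat_poly)
  then have "(fact k :: 'a poly3) * [:[:[:1 / fact k:]:]:] = 1"
    by (simp add: one_pCons)
  then show ?thesis
    unfolding poly3_binom_def by (simp only: mult.assoc [symmetric] mult_1)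
qed

lemma poly_poly3_binom:
  "poly (poly (poly (p pchoose k) [:[:c:]:]) [:b:]) a = poly (poly (poly p [:[:c:]:]) [:b:]) a gchoose k"
  by (simp add: poly3_binom_def gbinomial_prod_rev poly_prod)

end

theory Submission
  imports Defs "HOL-Computational_Algebra.Formal_Power_Series"
begin

text \<open>
  Expand \<open>binom(m - 1 - y, k + m) = (-1)^(k + m) binom(y + k, k + m)\<close> by Vandermonde's convolution
  in terms of \<open>binom(y, j + m)\<close>, rewrite \<open>binom(x, k) binom(k, j) = binom(x, j) binom(x - j, k - j)\<close>
  and exchange the sums: the inner sum over \<open>k\<close> is again a Vandermonde convolution. This proves the
  identity for field elements, hence for polynomials, because the field is infinite. For \<open>m = 0\<close> and
  \<open>x + y = -1\<close> the left-hand side is symmetric in \<open>x\<close> and \<open>y\<close> while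
  \<open>binom(m - 1 - y, k) = binom(x, k)\<close>; suitable values of \<open>z\<close> give the other two identities.
\<close>

lemma gbinomial_negate:
  fixes y :: "'a::field_char_0"
  shows "((of_nat k - 1 - y) gchoose k) = (-1) ^ k * (y gchoose k)"
proof -
  have "(y gchoose k) = (-1) ^ k * ((of_nat k - 1 - y) gchoose k)"
    using gbinomial_negated_upper[of y k] by (simp add: algebra_simps)
  then show ?thesis
    by simp
qed

text \<open>Vandermonde's convolution at degree \<open>k + m\<close>. Terms with
  \<open>i < m\<close> vanish since then \<open>k + m - i > k\<close>; the shift
  \<open>i = j + m\<close> leaves \<open>k choose (k - j)\<close>, which symmetry turns into
  \<open>k choose j\<close>.\<close>

lemma gbinomial_add_of_nat_expand:
  fixes y :: "'a::field_char_0"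
  shows "((y + of_nat k) gchoose (k + m)) = (\<Sum>j = 0..k. (y gchoose (j + m)) * of_nat (k choose j))"
proof -
  have "((y + of_nat k) gchoose (k + m))
      = (\<Sum>i = 0..k + m. (y gchoose i) * of_nat (k choose (k + m - i)))"
    using gbinomial_Vandermonde[of y "of_nat k" "k + m"] by (simp add: binomial_gbinomial)
  also have "\<dots> = (\<Sum>i\<in>{m..k + m}. (y gchoose i) * of_nat (k choose (k + m - i)))"
    by (rule sum.mono_neutral_right) (auto simp: binomial_eq_0)
  also have "\<dots> = (\<Sum>j\<in>{0..k}. (y gchoose (j + m)) * of_nat (k choose (k + m - (j + m))))"
    using sum.shift_bounds_cl_nat_ivl[of "\<lambda>i. (y gchoose i) * of_nat (k choose (k + m - i))" 0 m k]
    by simp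
  also have "\<dots> = (\<Sum>j = 0..k. (y gchoose (j + m)) * of_nat (k choose j))"
    by (intro sum.cong refl) (simp add: binomial_symmetric[symmetric])
  finally show ?thesis .
qed

lemma sum_gbinomial_triple:
  fixes x y z :: "'a::field_char_0"
  shows "(-1) ^ (m + n) *
        (\<Sum>k = 0..n. (-1) ^ k * (x gchoose k) * (y gchoose (k + m)) * (z gchoose (n - k)))
      = (\<Sum>k = 0..n. (-1) ^ k * (x gchoose k) * ((of_nat m - 1 - y) gchoose (k + m))
            * ((of_nat n - x - z - 1) gchoose (n - k)))"
proof -
  \<comment> \<open>Only the value of \<open>x + w\<close> matters: it is free of \<open>x\<close>,
    which lets the later convolution collapse to a coefficient in \<open>z\<close> alone.\<close>
  define w where "w = of_nat n - x - z - 1"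
  have summand: "(-1) ^ k * (x gchoose k) * ((of_nat m - 1 - y) gchoose (k + m)) * (w gchoose (n - k))
      = (\<Sum>j = 0..k. (-1) ^ m * (x gchoose j) * (y gchoose (j + m))
          * (((x - of_nat j) gchoose (k - j)) * (w gchoose (n - k))))" for k
  proof -
    \<comment> \<open>Negating the upper entry \<open>y + k\<close> at lower index
      \<open>k + m\<close> gives \<open>(k + m) - 1 - (y + k)\<close>, where \<open>k\<close>
      cancels.\<close>
    have neg: "((of_nat m - 1 - y) gchoose (k + m)) = (-1) ^ (k + m) * ((y + of_nat k) gchoose (k + m))"
      using gbinomial_negate[of "k + m" "y + of_nat k"] by (simp add: algebra_simps)
    have sign: "(-1) ^ k * (-1) ^ (k + m) = ((-1) ^ m :: 'a)"
      by (simp add: power_add)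
    have "(-1) ^ k * (x gchoose k) * ((of_nat m - 1 - y) gchoose (k + m)) * (w gchoose (n - k))
        = ((-1) ^ k * (-1) ^ (k + m)) * (x gchoose k) * ((y + of_nat k) gchoose (k + m))
          * (w gchoose (n - k))"
      by (simp only: neg mult_ac)
    also have "\<dots> = (\<Sum>j = 0..k. (-1) ^ m * (y gchoose (j + m))
        * ((x gchoose k) * of_nat (k choose j)) * (w gchoose (n - k)))"
      by (simp only: sign gbinomial_add_of_nat_expand sum_distrib_left sum_distrib_right mult_ac)
    \<comment> \<open>Trinomial revision separates the factors depending only on \<open>j\<close>
      from those that are later summed over \<open>k\<close>.\<close>
    also have "\<dots> = (\<Sum>j = 0..k. (-1) ^ m * (x gchoose j) * (y gchoose (j + m))
          * (((x - of_nat j) gchoose (k - j)) * (w gchoose (n - k))))"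
      by (intro sum.cong refl)
        (simp add: gbinomial_trinomial_revision binomial_gbinomial)
    finally show ?thesis .
  qed
  have inner: "(\<Sum>k = j..n. ((x - of_nat j) gchoose (k - j)) * (w gchoose (n - k)))
      = (-1) ^ (n - j) * (z gchoose (n - j))" if "j \<le> n" for j
  proof -
    have "(\<Sum>k = j..n. ((x - of_nat j) gchoose (k - j)) * (w gchoose (n - k)))
        = (\<Sum>i = 0..n - j. ((x - of_nat j) gchoose i) * (w gchoose (n - j - i)))"
      using that
      by (intro sum.reindex_bij_witness[of _ "\<lambda>i. i + j" "\<lambda>k. k - j"]) auto
    also have "\<dots> = ((x - of_nat j + w) gchoose (n - j))"
      by (rule gbinomial_Vandermonde)
    \<comment> \<open>This upper entry has exactly the shape that \<open>gbinomial_negate\<close>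
      needs at lower index \<open>n - j\<close>.\<close>
    also have "x - of_nat j + w = of_nat (n - j) - 1 - z"
      using that by (simp add: w_def)
    finally show ?thesis
      by (simp only: gbinomial_negate)
  qed
  have "(\<Sum>k = 0..n. (-1) ^ k * (x gchoose k) * ((of_nat m - 1 - y) gchoose (k + m))
          * (w gchoose (n - k)))
      = (\<Sum>k = 0..n. \<Sum>j = 0..k. (-1) ^ m * (x gchoose j) * (y gchoose (j + m))
          * (((x - of_nat j) gchoose (k - j)) * (w gchoose (n - k))))"
    by (simp only: summand)
  also have "\<dots> = (\<Sum>j = 0..n. \<Sum>k = j..n. (-1) ^ m * (x gchoose j) * (y gchoose (j + m))
          * (((x - of_nat j) gchoose (k - j)) * (w gchoose (n - k))))"
    \<comment> \<open>Both double sums run over the triangle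
      \<open>j \<le> k \<le> n\<close>.\<close>
    unfolding sum.Sigma[OF finite_atLeastAtMost ballI[OF finite_atLeastAtMost]]
    by (rule sum.reindex_bij_witness[of _ "\<lambda>(j, k). (k, j)" "\<lambda>(k, j). (j, k)"]) auto
  also have "\<dots> = (\<Sum>j = 0..n. (-1) ^ m * (x gchoose j) * (y gchoose (j + m))
          * ((-1) ^ (n - j) * (z gchoose (n - j))))"
    by (intro sum.cong refl) (simp add: inner flip: sum_distrib_left)
  also have "\<dots> = (-1) ^ (m + n) *
        (\<Sum>k = 0..n. (-1) ^ k * (x gchoose k) * (y gchoose (k + m)) * (z gchoose (n - k)))"
    unfolding sum_distrib_left
  proof (intro sum.cong refl)
    fix j assume "j \<in> {0..n}"
    then have "(-1) ^ (n - j) = ((-1) ^ n * (-1) ^ j :: 'a)"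
      by (simp add: power_diff minus_one_power_iff)
    then show "(-1) ^ m * (x gchoose j) * (y gchoose (j + m)) * ((-1) ^ (n - j) * (z gchoose (n - j)))
        = (-1) ^ (m + n) * ((-1) ^ j * (x gchoose j) * (y gchoose (j + m)) * (z gchoose (n - j)))"
      by (simp add: power_add)
  qed
  finally show ?thesis
    by (simp add: w_def)
qed

text \<open>The case \<open>m = 0\<close> of the triple-product identity at \<open>n - z\<close> in
  place of \<open>z\<close>: since \<open>y = -1 - x\<close>, the upper entry
  \<open>m - 1 - y\<close> becomes \<open>x\<close>, which produces the square, and the last upper
  entry becomes \<open>y + z\<close>. The gain is a right-hand side symmetric in \<open>x\<close>
  and \<open>y\<close>.\<close>

lemma sum_gbinomial_square:
  fixes x y z :: "'a::field_char_0"
  assumes "x + y = -1"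
  shows "(\<Sum>k = 0..n. (-1) ^ k * (x gchoose k) ^ 2 * ((y + z) gchoose (n - k)))
      = (-1) ^ n *
        (\<Sum>k = 0..n. (-1) ^ k * (x gchoose k) * (y gchoose k) * ((of_nat n - z) gchoose (n - k)))"
proof -
  have "y = -1 - x"
    using assms by (simp add: eq_diff_eq add.commute)
  then have "of_nat 0 - 1 - y = x" and "of_nat n - x - (of_nat n - z) - 1 = y + z"
    by simp_all
  with sum_gbinomial_triple[of 0 n x y "of_nat n - z"] show ?thesis
    by (simp only: power2_eq_square mult.assoc add_0 add_0_right)
qed

lemma poly_eqI_infinite:
  fixes p q :: "'a::idom poly"
  assumes "infinite S" and "\<And>s. s \<in> S \<Longrightarrow> poly p s = poly q s"
  shows "p = q"
proof (rule ccontr)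
  assume "p \<noteq> q"
  then have "finite {s. poly (p - q) s = 0}"
    by (intro poly_roots_finite) simp
  moreover have "S \<subseteq> {s. poly (p - q) s = 0}"
    using assms(2) by auto
  ultimately show False
    using assms(1) finite_subset by blast
qed

text \<open>Coefficients are compared one variable at a time, first in \<open>x\<close>, then
  \<open>y\<close>, then \<open>z\<close>. The outer two variables are evaluated only at constant
  polynomials, which already form an infinite set because the field has characteristic 0.\<close>

lemma poly3_eqI:
  fixes p q :: "'a::field_char_0 poly3"
  assumes "\<And>a b c. poly (poly (poly p [:[:c:]:]) [:b:]) a = poly (poly (poly q [:[:c:]:]) [:b:]) a"
  shows "p = q"
proof -
  have inf: "infinite (UNIV :: 'a set)"
    by (rule infinite_UNIV_char_0)
  have inf1: "infinite (range (\<lambda>b :: 'a. [:b:]))"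
    using inf by (auto dest!: finite_imageD simp: inj_on_def)
  have inf2: "infinite (range (\<lambda>c :: 'a. [:[:c:]:]))"
    using inf by (auto dest!: finite_imageD simp: inj_on_def)
  have "poly (poly p [:[:c:]:]) [:b:] = poly (poly q [:[:c:]:]) [:b:]" for b c
    using poly_eqI_infinite[OF inf] assms by blast
  then have "poly p [:[:c:]:] = poly q [:[:c:]:]" for c
    using poly_eqI_infinite[OF inf1] by blast
  then show ?thesis
    using poly_eqI_infinite[OF inf2] by blast
qed

theorem theorem1p3:
  fixes m n :: nat
  shows
    "(-1) ^ (m + n) *
        (\<Sum>k = 0..n. (-1) ^ k * ((var_x :: 'a::field_char_0 poly3) pchoose k)
            * (var_y pchoose (k + m)) * (var_z pchoose (n - k)))
      = (\<Sum>k = 0..n. (-1) ^ k * (var_x pchoose k)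
            * ((of_nat m - 1 - var_y) pchoose (k + m))
            * ((of_nat n - var_x - var_z - 1) pchoose (n - k)))
     \<and> (\<forall>x y :: 'a. x + y = -1 \<longrightarrow>
          (\<forall>d :: nat.
            (\<Sum>k = 0..n. (-1) ^ k * (of_nat (n + d) gchoose (k + d)) * (x gchoose k) * (y gchoose k))
            = (-1) ^ n * (\<Sum>k = 0..n. (-1) ^ k * (x gchoose k) ^ 2 * ((y - of_nat d) gchoose (n - k))))
        \<and> (\<forall>z :: 'a.
            (\<Sum>k = 0..n. (-1) ^ k * (x gchoose k) ^ 2 * ((y + z) gchoose (n - k)))
            = (\<Sum>k = 0..n. (-1) ^ k * (y gchoose k) ^ 2 * ((x + z) gchoose (n - k)))))"
proof (intro conjI allI impI)
  \<comment> \<open>Evaluation at scalars \<open>a\<close>, \<open>b\<close>, \<open>c\<close> turns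
    the polynomial identity into \<open>sum_gbinomial_triple\<close>.\<close>
  have "poly (poly (poly (var_x :: 'a poly3) [:[:c:]:]) [:b:]) a = a"
    and "poly (poly (poly (var_y :: 'a poly3) [:[:c:]:]) [:b:]) a = b"
    and "poly (poly (poly (var_z :: 'a poly3) [:[:c:]:]) [:b:]) a = c" for a b c
    by (simp_all add: var_x_def var_y_def var_z_def)
  then show "(-1) ^ (m + n) *
        (\<Sum>k = 0..n. (-1) ^ k * ((var_x :: 'a poly3) pchoose k)
            * (var_y pchoose (k + m)) * (var_z pchoose (n - k)))
      = (\<Sum>k = 0..n. (-1) ^ k * (var_x pchoose k)
            * ((of_nat m - 1 - var_y) pchoose (k + m))
            * ((of_nat n - var_x - var_z - 1) pchoose (n - k)))"
    by (intro poly3_eqI) (simp add: poly_sum poly_poly3_binom sum_gbinomial_triple)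
next
  fix x y :: 'a and d :: nat
  assume xy: "x + y = -1"
  have choose_sym: "(of_nat (n + d) gchoose (n - k) :: 'a) = (of_nat (n + d) gchoose (k + d))" if "k \<le> n" for k
    using that binomial_symmetric[of "k + d" "n + d"] by (simp flip: binomial_gbinomial of_nat_add)
  have "(-1) ^ n * (\<Sum>k = 0..n. (-1) ^ k * (x gchoose k) ^ 2 * ((y - of_nat d) gchoose (n - k)))
      = (\<Sum>k = 0..n. (-1) ^ k * (x gchoose k) * (y gchoose k) * (of_nat (n + d) gchoose (n - k)))"
    \<comment> \<open>With \<open>z = -d\<close> the upper entry \<open>n - z\<close> is
      \<open>n + d\<close>, and the two signs \<open>(-1) ^ n\<close> cancel.\<close>
    using sum_gbinomial_square[OF xy, of "- of_nat d" n]
    by simp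
  also have "\<dots> = (\<Sum>k = 0..n. (-1) ^ k * (of_nat (n + d) gchoose (k + d)) * (x gchoose k) * (y gchoose k))"
    by (intro sum.cong refl) (simp add: choose_sym mult_ac del: of_nat_add)
  finally show "(\<Sum>k = 0..n. (-1) ^ k * (of_nat (n + d) gchoose (k + d)) * (x gchoose k) * (y gchoose k))
      = (-1) ^ n * (\<Sum>k = 0..n. (-1) ^ k * (x gchoose k) ^ 2 * ((y - of_nat d) gchoose (n - k)))"
    by (rule sym)
next
  fix x y z :: 'a
  assume xy: "x + y = -1"
  then have yx: "y + x = -1"
    by (simp add: add.commute)
  show "(\<Sum>k = 0..n. (-1) ^ k * (x gchoose k) ^ 2 * ((y + z) gchoose (n - k)))
      = (\<Sum>k = 0..n. (-1) ^ k * (y gchoose k) ^ 2 * ((x + z) gchoose (n - k)))"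
    \<comment> \<open>Both sides reduce to the same sum up to exchanging the factors in
      \<open>x\<close> and \<open>y\<close>.\<close>
    unfolding sum_gbinomial_square[OF xy] sum_gbinomial_square[OF yx] by (simp only: mult_ac)
qed

end
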